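(* For all integers $n\ge 2$, $k\ge 1$ and $t\ge 1$, $\pi_t(P_n^{(k)})=p_t(n,k)$.
   Context: For positive integers $n,k$, $P_n^{(k)}$ is the graph with vertices $v_1,\dots,v_n$ in which $v_i\sim v_j$ iff $1\le |i-j|\le k$. For $n\ge 2$ put $d=\lfloor (n-2)/k\rfloor+1$, $b=(n-2)-k(d-1)$, and $p_t(n,k)=\max\{t2^d+b,\ 2t+n-2\}$. A configuration on a graph $G$ is $C:V(G)\to\mathbb{N}$ of size $|C|=\sum_vC(v)$; a pebbling step from a vertex with at least two pebbles to a neighbor removes two pebbles from the first and adds one to the second. $C$ is $t$-fold $r$-solvable if some sequence of pebbling steps places at least $t$ pebbles on $r$; $\pi_t(G,r)$ is the least $m$ such that every configuration of size $m$ is $t$-fold $r$-solvable; $\pi_t(G)=\max_{r}\pi_t(G,r)$. *)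

theory Defs
  imports "Graph_Theory.Pair_Digraph"
begin

text \<open>
  A simple graph is a symmetric loop-free digraph without parallel arcs, i.e. an instance of the
  locale \<^locale>\<open>pair_graph\<close>; each edge \<open>u \<sim> v\<close> is the pair of arcs \<open>(u, v)\<close>, \<open>(v, u)\<close>.
\<close>

definition path_power :: "nat \<Rightarrow> nat \<Rightarrow> nat pair_pre_digraph" where
  "path_power n k =
    \<lparr> pverts = {1..n},
      parcs = {(i, j). i \<in> {1..n} \<and> j \<in> {1..n} \<and>
        1 \<le> \<bar>int i - int j\<bar> \<and> \<bar>int i - int j\<bar> \<le> int k} \<rparr>"

lemma pair_graph_path_power: "pair_graph (path_power n k)"
proof
  show "finite (pverts (path_power n k))"
    by (simp add: path_power_def)
  show "finite (parcs (path_power n k))"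
    by (rule finite_subset[of _ "{1..n} \<times> {1..n}"]) (auto simp: path_power_def)
  show "symmetric (with_proj (path_power n k))"
    by (auto simp: path_power_def symmetric_def arcs_ends_def arc_to_ends_def intro!: symI)
qed (auto simp: path_power_def)

text \<open>
  A configuration on \<open>G\<close> is a function \<open>C :: 'a \<Rightarrow> nat\<close>. Its values outside \<open>pverts G\<close> are
  irrelevant: they do not contribute to the size and no pebbling step involves them.
\<close>

definition config_size :: "'a pair_pre_digraph \<Rightarrow> ('a \<Rightarrow> nat) \<Rightarrow> nat" where
  "config_size G C = (\<Sum>v\<in>pverts G. C v)"

definition pebbling_step :: "'a pair_pre_digraph \<Rightarrow> ('a \<Rightarrow> nat) \<Rightarrow> ('a \<Rightarrow> nat) \<Rightarrow> bool" where
  "pebbling_step G C C' \<longleftrightarrow>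
    (\<exists>u v. (u, v) \<in> parcs G \<and> 2 \<le> C u \<and> C' = C(u := C u - 2, v := C v + 1))"

definition fold_solvable :: "'a pair_pre_digraph \<Rightarrow> nat \<Rightarrow> 'a \<Rightarrow> ('a \<Rightarrow> nat) \<Rightarrow> bool" where
  "fold_solvable G t r C \<longleftrightarrow> (\<exists>C'. (pebbling_step G)\<^sup>*\<^sup>* C C' \<and> t \<le> C' r)"

definition rooted_pebbling_number :: "'a pair_pre_digraph \<Rightarrow> nat \<Rightarrow> 'a \<Rightarrow> nat" where
  "rooted_pebbling_number G t r =
    (LEAST m. \<forall>C. config_size G C = m \<longrightarrow> fold_solvable G t r C)"

definition pebbling_number :: "'a pair_pre_digraph \<Rightarrow> nat \<Rightarrow> nat" where
  "pebbling_number G t = Max (rooted_pebbling_number G t ` pverts G)"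

definition pd :: "nat \<Rightarrow> nat \<Rightarrow> nat" where
  "pd n k = (n - 2) div k + 1"

definition pb :: "nat \<Rightarrow> nat \<Rightarrow> nat" where
  "pb n k = (n - 2) - k * (pd n k - 1)"

definition p_bound :: "nat \<Rightarrow> nat \<Rightarrow> nat \<Rightarrow> nat" where
  "p_bound t n k = max (t * 2 ^ pd n k + pb n k) (2 * t + n - 2)"

end

theory Submission
  imports Defs "HOL-Library.Multiset"
begin

text \<open>
  Upper bound, root at one end: start with \<open>t\<close> demands on the root and sweep the vertices away from
  it. Two pebbles at the current vertex satisfy a demand, a single pebble moves the oldest demand to
  that vertex, and a demand that has not been served for \<open>k\<close> vertices becomes two demands on the
  current one. If \<open>m(s)\<close> denotes the number of demands after \<open>s\<close> further empty vertices and \<open>R + 1\<close>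
  vertices remain, then the pebbles still needed never exceed the maximum of \<open>2 m(s) + R - s\<close> over
  \<open>s \<le> R\<close>: among all adversaries, one that leaves vertices empty first and then uses single pebbles
  is optimal. By convexity in \<open>s\<close> the initial value of this maximum is the bound \<open>p\<^sub>t\<close>. An interior
  root is served independently from its two sides, since \<open>p\<close> is superadditive up to one pebble.

  Lower bound: two explicit configurations are unsolvable because a sum of functions of the pebble
  numbers on single vertices does not increase under pebbling steps.
\<close>

section \<open>Meeting demands\<close>

text \<open>A demand is one pebble wanted on a vertex. The sweep trades demands on the root for
  demands farther out, so the induction needs several target vertices at once, unlike
  \<open>fold_solvable\<close>.\<close>

definition meets :: "'a pair_pre_digraph \<Rightarrow> ('a \<Rightarrow> nat) \<Rightarrow> 'a multiset \<Rightarrow> bool" where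
  "meets G C M \<longleftrightarrow> (\<exists>C'. (pebbling_step G)\<^sup>*\<^sup>* C C' \<and> (\<forall>v. count M v \<le> C' v))"

lemma pebbling_step_add:
  assumes "pebbling_step G C C'"
  shows "pebbling_step G (\<lambda>v. C v + D v) (\<lambda>v. C' v + D v)"
proof -
  obtain u v where "(u, v) \<in> parcs G" "2 \<le> C u" "C' = C(u := C u - 2, v := C v + 1)"
    using assms unfolding pebbling_step_def by blast
  then show ?thesis
    unfolding pebbling_step_def by (intro exI[of _ u] exI[of _ v]) (auto simp: fun_eq_iff)
qed

lemma pebbling_steps_add:
  assumes "(pebbling_step G)\<^sup>*\<^sup>* C C'"
  shows "(pebbling_step G)\<^sup>*\<^sup>* (\<lambda>v. C v + D v) (\<lambda>v. C' v + D v)"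
  using assms
proof (induction rule: rtranclp_induct)
  case (step C1 C2)
  then show ?case
    using pebbling_step_add[of G C1 C2 D] by (meson rtranclp.rtrancl_into_rtrancl)
qed simp

text \<open>Extra pebbles never obstruct a step, so the two parts can be played one after the other.
  Separate portions of a configuration may thus serve separate demands.\<close>

lemma meets_add:
  assumes "meets G C M" and "meets G D K"
  shows "meets G (\<lambda>v. C v + D v) (M + K)"
proof -
  obtain C' where C': "(pebbling_step G)\<^sup>*\<^sup>* C C'" "\<And>v. count M v \<le> C' v"
    using assms(1) unfolding meets_def by blast
  obtain D' where D': "(pebbling_step G)\<^sup>*\<^sup>* D D'" "\<And>v. count K v \<le> D' v"
    using assms(2) unfolding meets_def by blast
  have "(pebbling_step G)\<^sup>*\<^sup>* (\<lambda>v. C v + D v) (\<lambda>v. C' v + D v)"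
    by (rule pebbling_steps_add[OF C'(1)])
  also have "(pebbling_step G)\<^sup>*\<^sup>* (\<lambda>v. C' v + D v) (\<lambda>v. C' v + D' v)"
    using pebbling_steps_add[OF D'(1), of C'] by (simp add: add.commute)
  finally show ?thesis
    unfolding meets_def using C'(2) D'(2)
    by (intro exI[of _ "\<lambda>v. C' v + D' v"]) (auto intro: add_mono)
qed

lemma meets_empty: "meets G C {#}"
  unfolding meets_def by auto

lemma meets_mono:
  assumes "meets G C M" and "\<And>v. C v \<le> D v"
  shows "meets G D M"
proof -
  have "D = (\<lambda>v. C v + (D v - C v))"
    using assms(2) by (simp add: fun_eq_iff)
  then show ?thesis
    using meets_add[OF assms(1) meets_empty[of G "\<lambda>v. D v - C v"]] by simp
qed

lemma meets_present: "meets G ((\<lambda>_. 0)(p := c)) (replicate_mset c p)"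
  unfolding meets_def by (intro exI[of _ "(\<lambda>_. 0)(p := c)"]) auto

lemma meets_add_pebbles:
  assumes "meets G C M"
  shows "meets G (C(p := C p + c)) (M + replicate_mset c p)"
proof -
  have "C(p := C p + c) = (\<lambda>v. C v + ((\<lambda>_. 0)(p := c)) v)"
    by (simp add: fun_eq_iff)
  then show ?thesis
    using meets_add[OF assms meets_present] by simp
qed

text \<open>Read backwards, a demand on \<open>x\<close> may be exchanged for two demands on a
  neighbor \<open>p\<close>.\<close>

lemma meets_step:
  assumes "meets G C (M + replicate_mset 2 p)" and "(p, x) \<in> parcs G"
  shows "meets G C (add_mset x M)"
proof -
  obtain C' where C': "(pebbling_step G)\<^sup>*\<^sup>* C C'"
      "\<And>v. count (M + replicate_mset 2 p) v \<le> C' v"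
    using assms(1) unfolding meets_def by blast
  have p: "count M p + 2 \<le> C' p"
    using C'(2)[of p] by simp
  have M: "count M v \<le> C' v" for v
    using C'(2)[of v] by simp
  have "pebbling_step G C' (C'(p := C' p - 2, x := C' x + 1))"
    unfolding pebbling_step_def using assms(2) p by (intro exI[of _ p] exI[of _ x]) simp
  with C'(1) have "(pebbling_step G)\<^sup>*\<^sup>* C (C'(p := C' p - 2, x := C' x + 1))"
    by simp
  moreover have "count (add_mset x M) v \<le> (C'(p := C' p - 2, x := C' x + 1)) v" for v
    using p M[of v] by auto
  ultimately show ?thesis
    unfolding meets_def by blast
qed

lemma fold_solvable_iff_meets: "fold_solvable G t r C \<longleftrightarrow> meets G C (replicate_mset t r)"
proof -
  have "t \<le> C' r \<longleftrightarrow> (\<forall>v. count (replicate_mset t r) v \<le> C' v)" for C'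
    by auto
  then show ?thesis
    unfolding fold_solvable_def meets_def by simp
qed

section \<open>Serving demands from one side\<close>

lemma arc_path_power:
  assumes "1 \<le> x" "x < p" "p \<le> x + k" "p \<le> n"
  shows "(p, x) \<in> parcs (path_power n k)"
  using assms by (auto simp: path_power_def)

text \<open>Vertex \<open>x + k\<close> is the last one from which a step reaches \<open>x\<close>,
  so a demand on \<open>x\<close> still open there has to be passed on as two demands on that
  vertex.\<close>

definition expire :: "nat \<Rightarrow> nat \<Rightarrow> nat multiset \<Rightarrow> nat multiset" where
  "expire k p M = (\<Sum>x\<in>#M. if x + k = p then {#p, p#} else {#x#})"

lemma expire_empty [simp]: "expire k p {#} = {#}"
  and expire_add_mset [simp]:
    "expire k p (add_mset x M) = (if x + k = p then {#p, p#} else {#x#}) + expire k p M"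
  by (simp_all add: expire_def)

lemma in_expire:
  assumes "y \<in># expire k p M"
  shows "y = p \<or> y \<in># M \<and> y + k \<noteq> p"
  using assms by (induction M) (auto split: if_splits)

lemma meets_expire:
  assumes "meets (path_power n k) C (expire k p M + K)"
    and "p \<le> n" and "1 \<le> k" and "\<forall>x\<in>#M. 1 \<le> x"
  shows "meets (path_power n k) C (M + K)"
  using assms
\<comment> \<open>\<open>K\<close> collects what is already treated, either two pebbles on
  \<open>p\<close> or a demand kept as it is, so it must vary.\<close>
proof (induction M arbitrary: K)
  case (add x M)
  show ?case
  proof (cases "x + k = p")
    case True
    have "meets (path_power n k) C (expire k p M + (K + replicate_mset 2 p))"
      using add.prems(1) True by (simp add: numeral_2_eq_2)
    then have "meets (path_power n k) C (M + (K + replicate_mset 2 p))"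
      using add.IH[of "K + replicate_mset 2 p"] add.prems by simp
    then have "meets (path_power n k) C ((M + K) + replicate_mset 2 p)"
      by (simp only: add.assoc)
    moreover have "(p, x) \<in> parcs (path_power n k)"
      using True add.prems by (intro arc_path_power) auto
    ultimately show ?thesis
      using meets_step by fastforce
  next
    case False
    then have "meets (path_power n k) C (expire k p M + add_mset x K)"
      using add.prems(1) by simp
    then show ?thesis
      using add.IH[of "add_mset x K"] add.prems by simp
  qed
qed simp

text \<open>
  The number of demands left over from \<open>M\<close> when all positions below \<open>p\<close> have been processed and
  the next \<open>s\<close> positions turn out to be empty: a demand at \<open>x\<close> then doubles at \<open>x + k\<close>,
  \<open>x + 2k\<close>, and so on.
\<close>

definition load :: "nat \<Rightarrow> nat \<Rightarrow> nat \<Rightarrow> nat multiset \<Rightarrow> nat" where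
  "load k p s M = (\<Sum>x\<in>#M. 2 ^ ((p + s - Suc x) div k))"

lemma load_empty [simp]: "load k p s {#} = 0"
  and load_add_mset [simp]:
    "load k p s (add_mset x M) = 2 ^ ((p + s - Suc x) div k) + load k p s M"
  by (simp_all add: load_def)

text \<open>An expired demand has \<open>p + Suc s - Suc x = k + s\<close>, so its exponent exceeds
  by one the exponent \<open>s div k\<close> of each of its two copies on \<open>p\<close>. For
  every other demand the shifts of \<open>p\<close> and \<open>s\<close> cancel.\<close>

lemma load_expire:
  assumes "1 \<le> k" and "\<forall>x\<in>#M. x < p \<and> p \<le> x + k"
  shows "load k (Suc p) s (expire k p M) = load k p (Suc s) M"
  using assms(2)
proof (induction M)
  case (add x M)
  have "2 ^ ((p + Suc s - Suc x) div k) = 2 * 2 ^ (s div k :: nat)" if "x + k = p"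
  proof -
    have "p + Suc s - Suc x = k + s"
      using that by simp
    then show ?thesis
      using assms(1) by (simp add: div_add_self1)
  qed
  then show ?case
    using add by auto
qed simp

lemma load_cong:
  assumes "\<And>x. x \<in># M \<Longrightarrow> (p + s - Suc x) div k = (p + s' - Suc x) div k"
  shows "load k p s M = load k p s' M"
  using assms by (induction M) auto

text \<open>
  A single pebble at \<open>p\<close> moves the oldest demand to \<open>p\<close>. Either this saves that demand a doubling
  within the next \<open>s + 1\<close> positions, which pays for the pebble, or no demand would double then.
\<close>

lemma load_move_oldest:
  assumes k: "1 \<le> k"
    and M: "\<forall>y\<in>#M. x \<le> y \<and> y < p \<and> p \<le> y + k" and x: "x < p" "p \<le> x + k"
  shows "load k p (Suc s) M + 2 ^ (s div k) < load k p (Suc s) (add_mset x M) \<or>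
         load k p (Suc s) M + 2 ^ (s div k) = load k p s (add_mset x M)"
proof (cases "s div k < (p + s - x) div k")
  case True
  then show ?thesis by simp
next
  case False
  \<comment> \<open>Both exponents lie between \<open>s div k\<close> and the exponent
    \<open>(p + s - x) div k\<close> of the oldest demand, which coincide in this case.\<close>
  have *: "(p + s - y) div k = s div k \<and> (p + s - Suc y) div k = s div k"
    if "x \<le> y" "y < p" for y
  proof -
    have "(p + s - y) div k \<le> (p + s - x) div k" "s div k \<le> (p + s - Suc y) div k"
      "(p + s - Suc y) div k \<le> (p + s - y) div k"
      using that by (intro div_le_mono; simp)+
    then show ?thesis using False by linarith
  qed
  have "load k p (Suc s) M = load k p s M"
    by (rule load_cong) (use * M in auto)
  moreover have "(p + s - Suc x) div k = s div k"
    using * x by blast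
  ultimately show ?thesis by simp
qed

lemma load_pos:
  assumes "M \<noteq> {#}"
  shows "1 \<le> load k p s M"
  using assms by (cases M) (auto simp: Suc_le_eq)

text \<open>The last hypothesis is the invariant of the sweep, stated for every number
  \<open>s\<close> of empty vertices that may follow. Each move advances \<open>p\<close> or spends
  pebbles, so the induction is on remaining vertices plus remaining pebbles.\<close>

lemma meets_if_load_le:
  assumes "1 \<le> k" and "p \<le> n"
    and "\<forall>x\<in>#M. 1 \<le> x \<and> x < p \<and> p \<le> x + k"
    and "\<forall>s\<le>n - p. 2 * load k p s M + (n - p) \<le> (\<Sum>v=p..n. C v) + s"
  shows "meets (path_power n k) C M"
  using assms(2-)
proof (induction "(n - p) + (\<Sum>v=p..n. C v)" arbitrary: p M C rule: less_induct)
  case less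
  let ?G = "path_power n k"
  let ?S = "\<Sum>v=p..n. C v"
  have split: "{p..n} = insert p {Suc p..n}"
    using less.prems(1) by auto
  have S: "?S = C p + (\<Sum>v=Suc p..n. C v)"
    unfolding split by simp
  show ?case
  proof (cases "M = {#}")
    case True
    then show ?thesis by (simp add: meets_empty)
  next
    case nonempty: False
    define x where "x = Min (set_mset M)"
    have xM: "x \<in># M" and x_le: "\<forall>y\<in>#M. x \<le> y"
      unfolding x_def using nonempty by auto
    then obtain M1 where M1: "M = add_mset x M1"
      by (meson multi_member_split)
    have arc: "(p, x) \<in> parcs ?G"
      using less.prems xM by (intro arc_path_power) auto
    consider "2 \<le> C p" | "C p \<le> 1" "p = n" | "C p = 0" "p < n" | "C p = 1" "p < n"
      using less.prems(1) by linarith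
    then show ?thesis
    proof cases
      case 1
      let ?C1 = "C(p := C p - 2)"
      have S1: "(\<Sum>v=p..n. ?C1 v) + 2 = ?S"
        unfolding split using 1 by simp
      \<comment> \<open>Every demand contributes at least 1 to the load, so dropping one compensates
        for the two pebbles spent.\<close>
      have "2 * load k p s M1 + (n - p) \<le> (\<Sum>v=p..n. ?C1 v) + s" if "s \<le> n - p" for s
      proof -
        have "2 * load k p s M1 + 2 \<le> 2 * load k p s M"
          unfolding M1 by simp
        then show ?thesis
          using less.prems(3) that S1 by fastforce
      qed
      then have "meets ?G ?C1 M1"
        using less.prems M1 S1 by (intro less.hyps[of p]) auto
      moreover have "?C1(p := ?C1 p + 2) = C"
        using 1 by (simp add: fun_eq_iff)
      ultimately have "meets ?G C (M1 + replicate_mset 2 p)"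
        using meets_add_pebbles[of ?G ?C1 M1 p 2] by (simp only:)
      then show ?thesis
        unfolding M1 using arc by (rule meets_step)
    next
      case 2
      \<comment> \<open>At the last vertex the invariant for \<open>s = 0\<close> would force two
        pebbles here.\<close>
      then have "2 * load k p 0 M \<le> C p"
        using less.prems(3) by auto
      then show ?thesis
        using load_pos[OF nonempty, of k p 0] 2 by linarith
    next
      case 3
      have "2 * load k (Suc p) s (expire k p M) + (n - Suc p) \<le> (\<Sum>v=Suc p..n. C v) + s"
        if "s \<le> n - Suc p" for s
      proof -
        have "2 * load k p (Suc s) M + (n - p) \<le> ?S + Suc s"
          using less.prems(3)[rule_format, of "Suc s"] that 3 by linarith
        moreover have "load k (Suc p) s (expire k p M) = load k p (Suc s) M"
          using assms(1) less.prems(2) by (intro load_expire) auto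
        ultimately show ?thesis
          using S 3 by simp
      qed
      moreover have "\<forall>y\<in>#expire k p M. 1 \<le> y \<and> y < Suc p \<and> Suc p \<le> y + k"
        using in_expire[of _ k p M] less.prems(2) assms(1) xM by fastforce
      ultimately have "meets ?G C (expire k p M)"
        using S 3 by (intro less.hyps[of "Suc p"]) auto
      then show ?thesis
        using meets_expire[of n k C p M "{#}"] less.prems assms(1) by simp
    next
      case 4
      \<comment> \<open>The pebble on \<open>p\<close> is half of what a step to \<open>x\<close>
        costs; the other half becomes a demand on \<open>p\<close>. The pebble is left out of
        \<open>?C1\<close> and put back at the end.\<close>
      let ?C1 = "C(p := 0)"
      let ?M' = "add_mset p (expire k p M1)"
      have S1: "(\<Sum>v=Suc p..n. ?C1 v) + 1 = ?S"
        using S 4 by simp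
      have "2 * load k (Suc p) s ?M' + (n - Suc p) \<le> (\<Sum>v=Suc p..n. ?C1 v) + s"
        if "s \<le> n - Suc p" for s
      proof -
        have "load k (Suc p) s (expire k p M1) = load k p (Suc s) M1"
          using assms(1) less.prems(2) M1 by (intro load_expire) auto
        then have "load k (Suc p) s ?M' = load k p (Suc s) M1 + 2 ^ (s div k)"
          by simp
        then have "load k (Suc p) s ?M' < load k p (Suc s) M \<or>
            load k (Suc p) s ?M' = load k p s M"
          using load_move_oldest[of k M1 x p s] assms(1) less.prems(2) x_le unfolding M1 by auto
        \<comment> \<open>The first alternative uses the invariant at \<open>Suc s\<close>, the
          second at \<open>s\<close>.\<close>
        moreover have "2 * load k p (Suc s) M + (n - p) \<le> ?S + Suc s"
          "2 * load k p s M + (n - p) \<le> ?S + s"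
          using less.prems(3)[rule_format, of "Suc s"] less.prems(3)[rule_format, of s] that 4
          by linarith+
        ultimately show ?thesis
          using S1 4 by linarith
      qed
      moreover have "\<forall>y\<in>#?M'. 1 \<le> y \<and> y < Suc p \<and> Suc p \<le> y + k"
        using in_expire[of _ k p M1] less.prems(2) assms(1) M1 by fastforce
      ultimately have "meets ?G ?C1 ?M'"
        using S1 4 by (intro less.hyps[of "Suc p"]) auto
      from meets_add_pebbles[OF this, of p 1]
      have "meets ?G C (expire k p M1 + replicate_mset 2 p)"
        using 4 by (simp add: numeral_2_eq_2 fun_upd_idem)
      then have "meets ?G C (expire k p M1 + {#x#})"
        using arc meets_step by fastforce
      then show ?thesis
        using meets_expire[of n k C p M1 "{#x#}"] less.prems assms(1) M1 by simp
    qed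
  qed
qed

section \<open>The bound\<close>

lemma le_two_power_minus_one: "i \<le> 2 ^ i - (1 :: nat)"
  using less_exp[of i] by linarith

text \<open>At \<open>s = k * i\<close> the quantity \<open>2 * t * 2 ^ i - k * i\<close> is convex
  in \<open>i\<close>, hence maximal at \<open>i = 0\<close> or \<open>i = D\<close>; these ends
  yield the two terms of \<open>p_bound\<close>. Other values of \<open>s\<close> only lower
  it.\<close>

lemma p_bound_ge:
  assumes "s \<le> n - 2" and "2 \<le> n"
  shows "2 * t * 2 ^ (s div k) + (n - 2) \<le> p_bound t n k + s"
proof -
  define i where "i = s div k"
  define D where "D = (n - 2) div k"
  have iD: "i \<le> D"
    unfolding i_def D_def using assms(1) by (rule div_le_mono)
  have ks: "k * i \<le> s"
    unfolding i_def by simp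
  have Dn: "k * D \<le> n - 2"
    unfolding D_def by simp
  have p1: "2 * t * 2 ^ D + (n - 2) \<le> p_bound t n k + k * D"
    unfolding p_bound_def pb_def pd_def D_def[symmetric] using Dn by simp
  have p2: "2 * t + (n - 2) \<le> p_bound t n k"
    unfolding p_bound_def using assms(2) by simp
  \<comment> \<open>Going from \<open>i\<close> to \<open>i + 1\<close> gains
    \<open>2 * t * 2 ^ i\<close> and costs \<open>k\<close>. If the gain is at least
    \<open>k\<close>, the end \<open>D\<close> dominates; otherwise the end 0 does.\<close>
  show ?thesis
  proof (cases "k \<le> 2 * t * 2 ^ i")
    case True
    have "k * (D - i) \<le> 2 * t * 2 ^ i * (2 ^ (D - i) - 1)"
      using True le_two_power_minus_one by (rule mult_le_mono)
    also have "\<dots> = 2 * t * 2 ^ D - 2 * t * 2 ^ i"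
      using iD by (simp add: algebra_simps diff_mult_distrib2 flip: power_add)
    finally have "k * (D - i) \<le> 2 * t * 2 ^ D - 2 * t * 2 ^ i" .
    moreover have "2 * t * 2 ^ i \<le> 2 * t * 2 ^ D"
      using iD by simp
    moreover have "k * D = k * (D - i) + k * i"
      using iD by (simp flip: distrib_left)
    ultimately show ?thesis
      using p1 ks unfolding i_def[symmetric] by linarith
  next
    case False
    have "2 * t * 2 ^ i \<le> 2 * t + k * i"
    proof (cases i)
      case (Suc j)
      have "k \<le> k * i" using Suc by simp
      then show ?thesis using False by linarith
    qed simp
    then show ?thesis
      using p2 ks unfolding i_def[symmetric] by linarith
  qed
qed

text \<open>One of the two ends attains the maximum, so \<open>p_bound\<close> can be handled as a
  single exponential term.\<close>

lemma p_bound_attained: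
  assumes "2 \<le> n"
  obtains i where "k * i \<le> n - 2" and "p_bound t n k + k * i = 2 * t * 2 ^ i + (n - 2)"
proof (cases "t * 2 ^ pd n k + pb n k \<le> 2 * t + n - 2")
  case True
  then have "p_bound t n k + k * 0 = 2 * t * 2 ^ 0 + (n - 2)"
    unfolding p_bound_def using assms by simp
  then show ?thesis using that[of 0] by simp
next
  case False
  have "pb n k + k * ((n - 2) div k) = n - 2"
    unfolding pb_def pd_def by (simp del: diff_diff_left)
  then have "p_bound t n k + k * ((n - 2) div k) = 2 * t * 2 ^ ((n - 2) div k) + (n - 2)"
    using False unfolding p_bound_def pd_def by simp
  then show ?thesis using that[of "(n - 2) div k"] by simp
qed

text \<open>Each extra demand raises both terms of the maximum by at least one. This accounts for
  pebbles already on the root and gives monotonicity in \<open>t\<close>.\<close>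

lemma p_bound_add_le:
  assumes "2 \<le> n"
  shows "p_bound t n k + c \<le> p_bound (t + c) n k"
proof -
  have "c * 1 \<le> c * 2 ^ pd n k" by (intro mult_le_mono) auto
  then have "t * 2 ^ pd n k + pb n k + c \<le> (t + c) * 2 ^ pd n k + pb n k"
    by (simp add: add_mult_distrib)
  moreover have "2 * t + n - 2 + c \<le> 2 * (t + c) + n - 2"
    using assms by simp
  ultimately show ?thesis
    unfolding p_bound_def by linarith
qed

text \<open>If the two sides attain their bounds at \<open>i\<close> and \<open>j\<close>, the
  instance \<open>s = k * (i + j)\<close> of \<open>p_bound_ge\<close> on the glued path
  suffices.\<close>

lemma p_bound_superadditive:
  assumes "1 \<le> l" and "1 \<le> q" and "1 \<le> k"
  shows "p_bound (Suc a) (Suc l) k + p_bound (Suc b) (Suc q) k \<le>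
         p_bound (Suc (a + b)) (Suc (l + q)) k + 1"
proof -
  obtain i where i: "k * i \<le> Suc l - 2"
      "p_bound (Suc a) (Suc l) k + k * i = 2 * Suc a * 2 ^ i + (Suc l - 2)"
    using p_bound_attained[of "Suc l" k "Suc a"] assms by auto
  obtain j where j: "k * j \<le> Suc q - 2"
      "p_bound (Suc b) (Suc q) k + k * j = 2 * Suc b * 2 ^ j + (Suc q - 2)"
    using p_bound_attained[of "Suc q" k "Suc b"] assms by auto
  have "k * (i + j) \<le> Suc (l + q) - 2"
    using i(1) j(1) assms by (simp add: distrib_left)
  then have ij: "2 * Suc (a + b) * 2 ^ (i + j) + (Suc (l + q) - 2) \<le>
      p_bound (Suc (a + b)) (Suc (l + q)) k + k * (i + j)"
    using p_bound_ge[of "k * (i + j)" "Suc (l + q)" "Suc (a + b)" k] assms by simp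
  \<comment> \<open>With powers \<open>Suc x\<close> and \<open>Suc y\<close>, the two sides of the
    next inequality differ by \<open>(a + b + 1) * x * y + b * x + a * y\<close>.\<close>
  obtain x y where xy: "(2::nat) ^ i = Suc x" "(2::nat) ^ j = Suc y"
    by (metis not0_implies_Suc power_not_zero zero_neq_numeral)
  have "Suc a * 2 ^ i + Suc b * 2 ^ j \<le> Suc (a + b) * 2 ^ (i + j) + 1"
    unfolding power_add xy by (simp add: algebra_simps)
  then have "2 * Suc a * 2 ^ i + 2 * Suc b * 2 ^ j \<le> 2 * Suc (a + b) * 2 ^ (i + j) + 2"
    unfolding mult.assoc by linarith
  moreover have "k * (i + j) = k * i + k * j"
    by (rule distrib_left)
  moreover have "Suc l - 2 + (Suc q - 2) + 1 = Suc (l + q) - 2"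
    using assms by simp
  ultimately show ?thesis
    using i(2) j(2) ij by linarith
qed

lemma two_mult_le_p_bound: "2 \<le> n \<Longrightarrow> 2 * t \<le> p_bound t n k"
  unfolding p_bound_def by simp

section \<open>Upper bound\<close>

text \<open>The sweep starts at \<open>Suc r\<close> with all demands on \<open>r\<close>; their
  load is \<open>t * 2 ^ (s div k)\<close>, so its invariant is \<open>p_bound_ge\<close> for the
  \<open>Suc (n - r)\<close> vertices from \<open>r\<close> on.\<close>

lemma meets_from_right:
  assumes "1 \<le> k" and "1 \<le> r" and "r < n"
    and "p_bound t (Suc (n - r)) k \<le> (\<Sum>v=Suc r..n. C v)"
  shows "meets (path_power n k) C (replicate_mset t r)"
proof (rule meets_if_load_le[where p = "Suc r"])
  show "\<forall>s\<le>n - Suc r. 2 * load k (Suc r) s (replicate_mset t r) + (n - Suc r)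
      \<le> (\<Sum>v=Suc r..n. C v) + s"
  proof (intro allI impI)
    fix s assume "s \<le> n - Suc r"
    moreover have "load k (Suc r) s (replicate_mset t r) = t * 2 ^ (s div k)"
      unfolding load_def by (induction t) auto
    ultimately show "2 * load k (Suc r) s (replicate_mset t r) + (n - Suc r)
        \<le> (\<Sum>v=Suc r..n. C v) + s"
      using p_bound_ge[of s "Suc (n - r)" t k] assms by (simp add: mult.assoc Suc_le_eq)
  qed
qed (use assms in auto)

section \<open>Reflection of the path\<close>

lemma pebbling_step_reflect:
  assumes "pebbling_step (path_power n k) C C'"
  shows "pebbling_step (path_power n k) (\<lambda>v. C (Suc n - v)) (\<lambda>v. C' (Suc n - v))"
proof -
  obtain u v where uv: "(u, v) \<in> parcs (path_power n k)" "2 \<le> C u"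
      "C' = C(u := C u - 2, v := C v + 1)"
    using assms unfolding pebbling_step_def by blast
  then have r: "u \<in> {1..n}" "v \<in> {1..n}"
    by (auto simp: path_power_def)
  then have "(Suc n - u, Suc n - v) \<in> parcs (path_power n k)"
    using uv(1) by (auto simp: path_power_def of_nat_diff)
  moreover have "Suc n - w = u \<longleftrightarrow> w = Suc n - u" "Suc n - w = v \<longleftrightarrow> w = Suc n - v" for w
    using r by auto
  ultimately show ?thesis
    unfolding pebbling_step_def using uv r
    by (intro exI[of _ "Suc n - u"] exI[of _ "Suc n - v"]) (auto simp: fun_eq_iff)
qed

text \<open>Truncated subtraction sends every \<open>v > n\<close> to 0; the vanishing of
  \<open>C\<close> off the path makes the double reflection the identity nevertheless.\<close>

lemma fold_solvable_reflect:
  assumes "fold_solvable (path_power n k) t (Suc n - r) (\<lambda>v. C (Suc n - v))"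
    and "r \<in> {1..n}" and "\<And>v. v \<notin> {1..n} \<Longrightarrow> C v = 0"
  shows "fold_solvable (path_power n k) t r C"
proof -
  let ?R = "\<lambda>C v. C (Suc n - v) :: nat"
  have *: "(pebbling_step (path_power n k))\<^sup>*\<^sup>* (?R D) (?R D')"
    if "(pebbling_step (path_power n k))\<^sup>*\<^sup>* D D'" for D D'
    using that
  proof (induction rule: rtranclp_induct)
    case (step D1 D2)
    then show ?case
      using pebbling_step_reflect[of n k D1 D2] by (meson rtranclp.rtrancl_into_rtrancl)
  qed simp
  obtain C' where C': "(pebbling_step (path_power n k))\<^sup>*\<^sup>* (?R C) C'" "t \<le> C' (Suc n - r)"
    using assms(1) unfolding fold_solvable_def by blast
  have "?R (?R C) = C"
  proof
    fix v
    show "?R (?R C) v = C v"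
      using assms(3)[of v] assms(3)[of 0] assms(3)[of "Suc n"]
      by (cases "v \<in> {1..n}") (auto simp: not_le)
  qed
  then show ?thesis
    unfolding fold_solvable_def using *[OF C'(1)] C'(2) by auto
qed

lemma meets_from_left:
  assumes "1 \<le> k" and "1 < r" and "r \<le> n"
    and "p_bound t r k \<le> (\<Sum>v=1..<r. C v)" and "\<And>v. v \<notin> {1..n} \<Longrightarrow> C v = 0"
  shows "meets (path_power n k) C (replicate_mset t r)"
proof -
  have "(\<Sum>v=Suc (Suc n - r)..n. C (Suc n - v)) = (\<Sum>v=1..<r. C v)"
    using assms(2,3)
    by (intro sum.reindex_bij_witness[of _ "\<lambda>v. Suc n - v" "\<lambda>v. Suc n - v"]) auto
  moreover have "Suc (n - (Suc n - r)) = r"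
    using assms(2,3) by simp
  ultimately have "meets (path_power n k) (\<lambda>v. C (Suc n - v)) (replicate_mset t (Suc n - r))"
    using assms by (intro meets_from_right) auto
  then show ?thesis
    using fold_solvable_reflect[of n k t r C] assms by (simp add: fold_solvable_iff_meets)
qed

section \<open>Arbitrary roots\<close>

text \<open>The largest number of demands that \<open>A\<close> pebbles are guaranteed to serve. The
  case \<open>a = 0\<close> is separate because \<open>p_bound 0 n k\<close> may be
  positive.\<close>

lemma largest_p_bound:
  assumes "2 \<le> n"
  obtains a where "a = 0 \<or> p_bound a n k \<le> A" and "A < p_bound (Suc a) n k"
proof -
  have ex: "A < p_bound (Suc A) n k"
    using two_mult_le_p_bound[OF assms, of "Suc A" k] by simp
  define a where "a = (LEAST a. A < p_bound (Suc a) n k)"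
  have "A < p_bound (Suc a) n k"
    unfolding a_def by (rule LeastI[of "\<lambda>a. A < p_bound (Suc a) n k", OF ex])
  moreover have "a = 0 \<or> p_bound a n k \<le> A"
  proof (cases a)
    case (Suc b)
    then have "\<not> A < p_bound (Suc b) n k"
      unfolding a_def by (intro not_less_Least) simp
    then show ?thesis using Suc by simp
  qed simp
  ultimately show ?thesis using that by blast
qed

text \<open>Each side serves as many demands as its bound guarantees. If these and the pebbles on
  \<open>r\<close> number fewer than \<open>t\<close>, the maximality of both numbers forces the
  size below \<open>p_bound t n k\<close>.\<close>

lemma fold_solvable_if_p_bound_le:
  assumes n: "2 \<le> n" and k: "1 \<le> k" and r: "r \<in> {1..n}"
    and size: "p_bound t n k \<le> config_size (path_power n k) C"
  shows "fold_solvable (path_power n k) t r C"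
proof (rule ccontr)
  assume neg: "\<not> fold_solvable (path_power n k) t r C"
  define L where "L = (\<Sum>v=1..<r. C v)"
  define R where "R = (\<Sum>v=Suc r..n. C v)"
  have V: "{1..n} = {1..<r} \<union> ({r} \<union> {Suc r..n})"
    using r by auto
  have total: "config_size (path_power n k) C = L + C r + R"
    unfolding config_size_def L_def R_def 
    by (simp add: path_power_def V del: One_nat_def) (subst sum.union_disjoint; auto)
  let ?CL = "\<lambda>v. if v \<in> {1..<r} then C v else 0"
  let ?CR = "\<lambda>v. if v \<in> {Suc r..n} then C v else 0"
  have few: "a + b + C r < t"
    if "meets (path_power n k) ?CL (replicate_mset a r)"
      and "meets (path_power n k) ?CR (replicate_mset b r)" for a b
  proof (rule ccontr)
    assume "\<not> a + b + C r < t"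
    have "meets (path_power n k) (\<lambda>v. (?CL v + ?CR v) + ((\<lambda>_. 0)(r := C r)) v)
        ((replicate_mset a r + replicate_mset b r) + replicate_mset (C r) r)"
      by (intro meets_add that meets_present)
    then have "meets (path_power n k) C
        ((replicate_mset a r + replicate_mset b r) + replicate_mset (C r) r)"
      by (rule meets_mono) auto
    moreover have "(replicate_mset a r + replicate_mset b r) + replicate_mset (C r) r =
        replicate_mset (a + b + C r) r"
      by (rule multiset_eqI) simp
    ultimately have "fold_solvable (path_power n k) (a + b + C r) r C"
      by (simp add: fold_solvable_iff_meets)
    then have "fold_solvable (path_power n k) t r C"
      unfolding fold_solvable_def using \<open>\<not> a + b + C r < t\<close> by (meson le_trans not_less)
    then show False using neg by simp
  qed
  have left: "\<exists>a. meets (path_power n k) ?CL (replicate_mset a r) \<and> L < p_bound (Suc a) r k"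
    if r1: "1 < r"
  proof -
    obtain a where a: "a = 0 \<or> p_bound a r k \<le> L" "L < p_bound (Suc a) r k"
      using largest_p_bound[of r k L] r1 by auto
    have "(\<Sum>v=1..<r. ?CL v) = L"
      unfolding L_def by (rule sum.cong) auto
    then have "meets (path_power n k) ?CL (replicate_mset a r)"
      using a(1)
    proof (elim disjE)
      assume "p_bound a r k \<le> L"
      then show ?thesis
        using that r k \<open>(\<Sum>v=1..<r. ?CL v) = L\<close> by (intro meets_from_left) auto
    qed (simp add: meets_empty)
    then show ?thesis using a(2) by blast
  qed
  have right: "\<exists>b. meets (path_power n k) ?CR (replicate_mset b r) \<and>
      R < p_bound (Suc b) (Suc (n - r)) k" if rn: "r < n"
  proof -
    obtain b where b: "b = 0 \<or> p_bound b (Suc (n - r)) k \<le> R"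
        "R < p_bound (Suc b) (Suc (n - r)) k"
      using largest_p_bound[of "Suc (n - r)" k R] rn by (auto simp: Suc_le_eq)
    have "(\<Sum>v=Suc r..n. ?CR v) = R"
      unfolding R_def by (rule sum.cong) auto
    then have "meets (path_power n k) ?CR (replicate_mset b r)"
      using b(1)
    proof (elim disjE)
      assume "p_bound b (Suc (n - r)) k \<le> R"
      then show ?thesis
        using that r k \<open>(\<Sum>v=Suc r..n. ?CR v) = R\<close> by (intro meets_from_right) auto
    qed (simp add: meets_empty)
    then show ?thesis using b(2) by blast
  qed
  have "\<exists>m. m + C r < t \<and> L + R < p_bound (Suc m) n k"
  proof -
    \<comment> \<open>An end root has only one side, while superadditivity needs both sides
      nonempty.\<close>
    consider "r = 1" "r < n" | "r = n" "1 < r" | "1 < r" "r < n"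
      using r n by fastforce
    then show ?thesis
    proof cases
      case 1
      then obtain b where "meets (path_power n k) ?CR (replicate_mset b r)"
          "R < p_bound (Suc b) n k"
        using right by auto
      then show ?thesis
        using few[of 0 b] 1 by (intro exI[of _ b]) (auto simp: meets_empty L_def)
    next
      case 2
      then obtain a where "meets (path_power n k) ?CL (replicate_mset a r)"
          "L < p_bound (Suc a) n k"
        using left by auto
      then show ?thesis
        using few[of a 0] 2 by (intro exI[of _ a]) (auto simp: meets_empty R_def)
    next
      case 3
      obtain a where a: "meets (path_power n k) ?CL (replicate_mset a r)"
          "L < p_bound (Suc a) r k"
        using left 3 by auto
      obtain b where b: "meets (path_power n k) ?CR (replicate_mset b r)"
          "R < p_bound (Suc b) (Suc (n - r)) k"
        using right 3 by auto
      \<comment> \<open>The excess of one is harmless since the bounds on \<open>L\<close> and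
        \<open>R\<close> are both strict.\<close>
      have "p_bound (Suc a) r k + p_bound (Suc b) (Suc (n - r)) k \<le> p_bound (Suc (a + b)) n k + 1"
        using p_bound_superadditive[of "r - 1" "n - r" k a b] 3 k by simp
      then show ?thesis
        using few[OF a(1) b(1)] a(2) b(2) by (intro exI[of _ "a + b"]) auto
    qed
  qed
  then obtain m where m: "m + C r < t" "L + R < p_bound (Suc m) n k"
    by blast
  have "p_bound (Suc m) n k + C r \<le> p_bound (Suc m + C r) n k"
    using n by (rule p_bound_add_le)
  also have "\<dots> \<le> p_bound t n k"
    using p_bound_add_le[OF n, of "Suc m + C r" k "t - (Suc m + C r)"] m(1) by simp
  finally show False
    using size total m(2) by linarith
qed

section \<open>Lower bound\<close>

text \<open>The condition on arcs says that no step raises the potential. Functions of the pebble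
  number, rather than linear weights, allow stranded single pebbles to count as nothing.\<close>

lemma separable_potential_bound:
  fixes f :: "'a \<Rightarrow> nat \<Rightarrow> nat"
  assumes G: "pair_graph G"
    and arc: "\<And>u v c c'. (u, v) \<in> parcs G \<Longrightarrow> f v (Suc c') + f u c \<le> f v c' + f u (c + 2)"
    and r: "r \<in> pverts G" and mono: "mono (f r)"
    and solv: "fold_solvable G t r C"
  shows "f r t \<le> (\<Sum>v\<in>pverts G. f v (C v))"
proof -
  interpret pair_graph G by (rule G)
  have step: "(\<Sum>v\<in>pverts G. f v (D' v)) \<le> (\<Sum>v\<in>pverts G. f v (D v))"
    if "pebbling_step G D D'" for D D'
  proof -
    obtain u v where uv: "(u, v) \<in> parcs G" "2 \<le> D u" "D' = D(u := D u - 2, v := D v + 1)"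
      using \<open>pebbling_step G D D'\<close> unfolding pebbling_step_def by blast
    have V: "u \<in> pverts G" "v \<in> pverts G"
      using uv(1) wellformed by force+
    have ne: "u \<noteq> v"
      using uv(1) no_loops by force
    have split: "pverts G = insert u (insert v (pverts G - {u, v}))"
      using V by auto
    have sum_eq: "(\<Sum>w\<in>pverts G. f w (E w)) =
        f u (E u) + (f v (E v) + (\<Sum>w\<in>pverts G - {u, v}. f w (E w)))" for E
      by (subst split) (simp add: ne)
    have "(\<Sum>w\<in>pverts G - {u, v}. f w (D' w)) = (\<Sum>w\<in>pverts G - {u, v}. f w (D w))"
      by (rule sum.cong) (auto simp: uv(3))
    moreover have "f v (D' v) + f u (D' u) \<le> f v (D v) + f u (D u)"
    proof -
      have "D' v = Suc (D v)" "D' u = D u - 2" "D u = D' u + 2"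
        using uv(2,3) ne by auto
      then show ?thesis
        using arc[OF uv(1), of "D v" "D' u"] by simp
    qed
    ultimately show ?thesis
      unfolding sum_eq by simp
  qed
  obtain C' where C': "(pebbling_step G)\<^sup>*\<^sup>* C C'" "t \<le> C' r"
    using solv unfolding fold_solvable_def by blast
  have "(\<Sum>v\<in>pverts G. f v (C' v)) \<le> (\<Sum>v\<in>pverts G. f v (C v))"
    using C'(1) by (induction rule: rtranclp_induct) (auto dest: step)
  moreover have "f r (C' r) \<le> (\<Sum>v\<in>pverts G. f v (C' v))"
    using r by (intro member_le_sum) auto
  moreover have "f r t \<le> f r (C' r)"
    using mono C'(2) by (rule monoD)
  ultimately show ?thesis by linarith
qed

lemma subconfig_of_size:
  fixes C :: "'a \<Rightarrow> nat"
  assumes "finite V" and "m \<le> (\<Sum>v\<in>V. C v)"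
  shows "\<exists>D. (\<forall>v. D v \<le> C v) \<and> (\<Sum>v\<in>V. D v) = m"
  using assms
proof (induction V arbitrary: m rule: finite_induct)
  case empty
  then show ?case by (intro exI[of _ C]) simp
next
  case (insert x V)
  obtain D where D: "\<forall>v. D v \<le> C v" "(\<Sum>v\<in>V. D v) = m - min m (C x)"
  proof -
    have "m - min m (C x) \<le> (\<Sum>v\<in>V. C v)"
      using insert.prems insert.hyps by simp
    then show ?thesis using insert.IH that by blast
  qed
  have "(\<Sum>v\<in>V. (D(x := min m (C x))) v) = (\<Sum>v\<in>V. D v)"
    using insert.hyps by (intro sum.cong) auto
  then show ?case
    using D insert.hyps by (intro exI[of _ "D(x := min m (C x))"]) auto
qed

text \<open>The least size speaks of configurations of exactly that size. An unsolvable
  configuration at least that large would contain one of exactly that size, whose solution carries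
  over; \<open>ex\<close> ensures that the least size exists.\<close>

lemma rooted_pebbling_number_gt:
  assumes G: "pair_graph G"
    and ex: "\<forall>C. config_size G C = M \<longrightarrow> fold_solvable G t r C"
    and bad: "\<not> fold_solvable G t r C"
  shows "config_size G C < rooted_pebbling_number G t r"
proof (rule ccontr)
  assume less: "\<not> config_size G C < rooted_pebbling_number G t r"
  interpret pair_graph G by (rule G)
  have all: "\<forall>D. config_size G D = rooted_pebbling_number G t r \<longrightarrow> fold_solvable G t r D"
    unfolding rooted_pebbling_number_def
    by (rule LeastI[of "\<lambda>m. \<forall>C. config_size G C = m \<longrightarrow> fold_solvable G t r C", OF ex])
  obtain D where D: "\<forall>v. D v \<le> C v" "config_size G D = rooted_pebbling_number G t r"
    using subconfig_of_size[of "pverts G" "rooted_pebbling_number G t r" C] less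
    unfolding config_size_def by auto
  then have "fold_solvable G t r C"
    using all meets_mono[of G D "replicate_mset t r" C] by (simp add: fold_solvable_iff_meets)
  then show False using bad by simp
qed

section \<open>Two extremal unsolvable configurations\<close>

text \<open>In the potential, an interior vertex ignores its first pebble and \<open>n\<close>
  counts pairs. A step costs its source at least 1 and gives its target at most 1, while the total
  starts at \<open>t - 1\<close>.\<close>

lemma unsolvable_spread:
  assumes "2 \<le> n" and "1 \<le> t"
  defines "C \<equiv> (\<lambda>_. 1 :: nat)(1 := 0, n := 2 * t - 1)"
  shows "\<not> fold_solvable (path_power n k) t 1 C"
    and "config_size (path_power n k) C + 1 = 2 * t + n - 2"
proof -
  have V: "{1..n} = insert 1 (insert n {2..n - 1})"
    using assms by auto
  show "\<not> fold_solvable (path_power n k) t 1 C"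
  proof
    assume solv: "fold_solvable (path_power n k) t 1 C"
    define f :: "nat \<Rightarrow> nat \<Rightarrow> nat" where
      "f = (\<lambda>v c. if v = 1 then c else if v = n then c div 2 else c - 1)"
    have "f 1 t \<le> (\<Sum>v\<in>pverts (path_power n k). f v (C v))"
    proof (rule separable_potential_bound[OF pair_graph_path_power _ _ _ solv])
      fix u v c c'
      have "f v (Suc c') \<le> f v c' + 1" "f u c + 1 \<le> f u (c + 2)"
        unfolding f_def by auto
      then show "f v (Suc c') + f u c \<le> f v c' + f u (c + 2)" by linarith
    qed (use assms in \<open>auto simp: path_power_def f_def mono_def\<close>)
    also have "\<dots> = t - 1"
    proof -
      have "(\<Sum>v=2..n - 1. f v (C v)) = 0"
        by (intro sum.neutral) (auto simp: f_def C_def)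
      moreover have "f 1 (C 1) = 0" "f n (C n) = t - 1"
        using assms(1,2) by (auto simp: f_def C_def)
      ultimately show ?thesis
        using assms(1) by (simp add: path_power_def V del: One_nat_def)
    qed
    finally show False
      using assms(2) by (simp add: f_def)
  qed
  show "config_size (path_power n k) C + 1 = 2 * t + n - 2"
  proof -
    have "(\<Sum>v=2..n - 1. C v) = (\<Sum>v=2..n - 1. 1)"
      by (intro sum.cong) (auto simp: C_def)
    moreover have "C 1 = 0" "C n = 2 * t - 1"
      using assms(1) by (auto simp: C_def)
    ultimately show ?thesis
      using assms(1,2) by (simp add: config_size_def path_power_def V del: One_nat_def)
  qed
qed

text \<open>
  The potential weights a pebble by its distance to the root, except that single pebbles on the
  farthest layer other than on \<open>n\<close> do not count.
\<close>

lemma unsolvable_far: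
  assumes "2 \<le> n" and "1 \<le> k" and "1 \<le> t"
  defines "d \<equiv> pd n k"
  defines "C \<equiv> (\<lambda>v. if v = n then t * 2 ^ d - 1 else if k * (d - 1) + 2 \<le> v then 1 else 0 :: nat)"
  shows "\<not> fold_solvable (path_power n k) t 1 C"
    and "config_size (path_power n k) C + 1 = t * 2 ^ d + pb n k"
proof -
  \<comment> \<open>The first vertex at distance \<open>d\<close> from 1; \<open>pb n k\<close>
    vertices lie from here up to \<open>n - 1\<close>.\<close>
  let ?e = "k * (d - 1) + 2"
  have d1: "1 \<le> d"
    unfolding d_def pd_def by simp
  have en: "?e \<le> n"
  proof -
    have "k * (d - 1) \<le> n - 2"
      unfolding d_def pd_def by simp
    then show ?thesis using assms(1) by linarith
  qed
  have pos: "1 \<le> t * 2 ^ d"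
    using assms(3) by simp
  have V: "{1..n} = {1..<?e} \<union> (insert n {?e..n - 1})"
    using en by auto
  have sum_V: "(\<Sum>v=1..n. g v) = (\<Sum>v=1..<?e. g v) + (g n + (\<Sum>v=?e..n - 1. g v))"
    for g :: "nat \<Rightarrow> nat"
    unfolding V using en by (subst sum.union_disjoint) auto
  show "\<not> fold_solvable (path_power n k) t 1 C"
  proof
    assume solv: "fold_solvable (path_power n k) t 1 C"
    \<comment> \<open>\<open>(v + k - 2) div k\<close> is the distance from \<open>v\<close> to 1,
      that is \<open>(v - 1) / k\<close> rounded up.\<close>
    define h where "h = (\<lambda>v. d - (v + k - 2) div k)"
    define f :: "nat \<Rightarrow> nat \<Rightarrow> nat" where
      "f = (\<lambda>v c. if v = n then c else if ?e \<le> v then 2 * (c div 2) else 2 ^ h v * c)"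
    have "(1 + k - 2) div k = 0"
      using assms(2) by simp
    then have h1: "h 1 = d"
      by (simp add: h_def)
    have h_far: "h v = 0" if "?e \<le> v" for v
    proof -
      have "k * d \<le> v + k - 2"
        using that d1 by (cases d) auto
      then have "d \<le> (v + k - 2) div k"
        using assms(2) by (simp add: less_eq_div_iff_mult_less_eq mult.commute)
      then show ?thesis by (simp add: h_def)
    qed
    have h_arc: "h v \<le> Suc (h u)" if "(u, v) \<in> parcs (path_power n k)" for u v
    proof -
      have "u \<le> v + k" "1 \<le> v" "1 \<le> u"
        using that by (auto simp: path_power_def)
      then have "(u + k - 2) div k \<le> ((v + k - 2) + k) div k"
        using assms(2) by (intro div_le_mono) linarith
      also have "\<dots> = Suc ((v + k - 2) div k)"
        using assms(2) by simp
      finally show ?thesis unfolding h_def by linarith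
    qed
    have "f 1 t \<le> (\<Sum>v\<in>pverts (path_power n k). f v (C v))"
    proof (rule separable_potential_bound[OF pair_graph_path_power _ _ _ solv])
      fix u v c c' assume a: "(u, v) \<in> parcs (path_power n k)"
      have "f u (c + 2) = f u c + 2 * 2 ^ h u"
        using h_far[of u] en by (auto simp: f_def algebra_simps)
      \<comment> \<open>The 2 covers a far vertex other than \<open>n\<close>, where completing a
        pair raises the potential by 2.\<close>
      moreover have "f v (Suc c') \<le> f v c' + max 2 (2 ^ h v)"
        by (auto simp: f_def)
      moreover have "(2::nat) ^ h v \<le> 2 ^ Suc (h u)"
        using h_arc[OF a] by (intro power_increasing) auto
      then have "max 2 (2 ^ h v) \<le> 2 * (2::nat) ^ h u"
        by simp
      ultimately show "f v (Suc c') + f u c \<le> f v c' + f u (c + 2)" by linarith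
    qed (use assms(1) in \<open>auto simp: path_power_def f_def mono_def intro!: div_le_mono\<close>)
    also have "\<dots> = t * 2 ^ d - 1"
    proof -
      have "(\<Sum>v=1..<?e. f v (C v)) = 0" "(\<Sum>v=?e..n - 1. f v (C v)) = 0"
        using en by (intro sum.neutral; auto simp: f_def C_def)+
      moreover have "f n (C n) = t * 2 ^ d - 1"
        by (simp add: f_def C_def)
      ultimately show ?thesis
        by (simp only: path_power_def pair_pre_digraph.simps sum_V)
    qed
    finally have "f 1 t \<le> t * 2 ^ d - 1" .
    moreover have "f 1 t = t * 2 ^ d"
      using assms(1) h1 by (simp add: f_def)
    ultimately show False
      using pos by linarith
  qed
  show "config_size (path_power n k) C + 1 = t * 2 ^ d + pb n k"
  proof -
    have "(\<Sum>v=1..<?e. C v) = 0"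
      using en by (intro sum.neutral) (auto simp: C_def)
    moreover have "(\<Sum>v=?e..n - 1. C v) = (\<Sum>v=?e..n - 1. 1)"
      using en by (intro sum.cong) (auto simp: C_def)
    moreover have "C n = t * 2 ^ d - 1"
      by (simp add: C_def)
    ultimately have "config_size (path_power n k) C = t * 2 ^ d - 1 + (n - 1 + 1 - ?e)"
      by (simp add: config_size_def path_power_def sum_V del: One_nat_def)
    moreover have "pb n k = n - 1 + 1 - ?e"
      unfolding pb_def d_def[symmetric] using en by linarith
    ultimately show ?thesis using pos by linarith
  qed
qed

theorem theorem6:
  fixes n k t :: nat
  assumes "2 \<le> n" and "1 \<le> k" and "1 \<le> t"
  shows "pebbling_number (path_power n k) t = p_bound t n k"
proof -
  let ?G = "path_power n k"
  have V: "pverts ?G = {1..n}"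
    by (simp add: path_power_def)
  have solv: "\<forall>C. config_size ?G C = p_bound t n k \<longrightarrow> fold_solvable ?G t r C"
    if "r \<in> {1..n}" for r
    using fold_solvable_if_p_bound_le assms that by simp
  have upper: "rooted_pebbling_number ?G t r \<le> p_bound t n k" if "r \<in> {1..n}" for r
    unfolding rooted_pebbling_number_def using solv[OF that] by (rule Least_le)
  \<comment> \<open>Each unsolvable configuration is one pebble short of one term of the maximum, so
    the end root 1 already attains the bound.\<close>
  have "p_bound t n k \<le> rooted_pebbling_number ?G t 1"
  proof -
    have ex: "\<forall>C. config_size ?G C = p_bound t n k \<longrightarrow> fold_solvable ?G t 1 C"
      using solv assms(1) by simp
    note gt = rooted_pebbling_number_gt[OF pair_graph_path_power ex]
    show ?thesis
      using gt[OF unsolvable_spread(1)[OF assms(1,3)]] unsolvable_spread(2)[OF assms(1,3), of k]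
        gt[OF unsolvable_far(1)[OF assms]] unsolvable_far(2)[OF assms]
      unfolding p_bound_def by linarith
  qed
  with upper[of 1] assms(1) have "rooted_pebbling_number ?G t 1 = p_bound t n k"
    by simp
  then show ?thesis
    unfolding pebbling_number_def V using upper assms(1)
    by (intro Max_eqI) (auto intro: rev_image_eqI[of 1])
qed

end
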